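(* Let $(P,<)$ be a finite poset, $P^*\subset P$ a set of marked elements containing all minimal and maximal elements of $(P,<)$, and $\lambda\in\mathbb Z^{P^*}$ a dominant marking. Let $<'$ and $<''$ be two orders on $P$, each satisfying the conditions (stated for $<'$): (i) $<'$ is weaker than $<$; (ii) $\mathcal J(P,<)$ is closed under $*_{P,<'}$; (iii) $p\not<'q$ for any $p\in P^*$ and $q\in P$. Then the polytopes $\mathcal R_\lambda(P,<,<')$ and $\mathcal R_\lambda(P,<,<'')$ are Ehrhart-equivalent.
   Context: $\mathcal J=\mathcal J(P,<)$ is the set of order ideals (lower sets). $<'$ is weaker than $<$ if $p<'q$ implies $p<q$. $\max_{<'}A$ is the set of $<'$-maximal elements of $A$; $\mathbf 1_A$ the indicator vector. $J_1*_{P,<'}J_2$ is the order ideal of $(P,<')$ generated by $(J_1\cap J_2)\cap(\max_{<'}J_1\cup\max_{<'}J_2)$. A marking $\lambda\in\mathbb Z^{P^*}$ is dominant if $\lambda_p\ge\lambda_q$ for $p<q$ in $P^*$. Marked relative poset polytope: for $K\in\mathcal J(P^*,<)$ put $\omega_K=\mathbf 1_K\in\mathbb R^{P^*}$ and let $\mathcal R_{\omega_K}(P,<,<')\subset\mathbb R^P$ be the convex hull of $\mathbf 1_{\max_{<'}J}$ over $J\in\mathcal J$ with $J\cap P^*=K$. If $\lambda$ is dominant with nonnegative coordinates there is a unique expression $\lambda=\sum_K\alpha_K(\lambda)\omega_K$ with $\alpha_K(\lambda)\in\mathbb Z_{\ge0}$, $\alpha_\varnothing(\lambda)=0$ and $\{K:\alpha_K(\lambda)>0\}$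 a chain under inclusion; then $\mathcal R_\lambda(P,<,<')$ is the Minkowski sum $\sum_K\alpha_K(\lambda)\mathcal R_{\omega_K}(P,<,<')$. In general $\mathcal R_\lambda(P,<,<')=\mathcal R_{\lambda+\beta\omega_{P^*}}(P,<,<')-\beta\mathbf 1_{\max_{<'}P}$ for any integer $\beta$ making $\lambda+\beta\omega_{P^*}$ nonnegative (independent of $\beta$). Two lattice polytopes $Q,Q'$ are Ehrhart-equivalent if $mQ$ and $mQ'$ have the same number of integer points for every integer $m\ge0$. *)

theory Defs
  imports "HOL-Analysis.Analysis"
begin

text \<open>
  A finite poset is a subset \<open>P\<close> of a finite type \<open>'a\<close> together with a strict order relation
  \<open>lt\<close>, of which only the restriction to \<open>P\<close> matters.  The space of real vectors indexed by \<open>P\<close> is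
  identified with the coordinate subspace of \<^typ>\<open>real ^ 'a\<close> of vectors vanishing outside \<open>P\<close>.
\<close>

definition strict_order_on :: "'a set \<Rightarrow> ('a \<Rightarrow> 'a \<Rightarrow> bool) \<Rightarrow> bool" where
  "strict_order_on P lt \<longleftrightarrow> irreflp_on P lt \<and> transp_on P lt"

definition order_ideals :: "'a set \<Rightarrow> ('a \<Rightarrow> 'a \<Rightarrow> bool) \<Rightarrow> 'a set set" where
  "order_ideals P lt = {J. J \<subseteq> P \<and> (\<forall>q\<in>J. \<forall>p\<in>P. lt p q \<longrightarrow> p \<in> J)}"

definition maximals :: "('a \<Rightarrow> 'a \<Rightarrow> bool) \<Rightarrow> 'a set \<Rightarrow> 'a set" where
  "maximals lt A = {p \<in> A. \<not> (\<exists>q\<in>A. lt p q)}"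

definition minimals :: "('a \<Rightarrow> 'a \<Rightarrow> bool) \<Rightarrow> 'a set \<Rightarrow> 'a set" where
  "minimals lt A = {p \<in> A. \<not> (\<exists>q\<in>A. lt q p)}"

definition ideal_star :: "'a set \<Rightarrow> ('a \<Rightarrow> 'a \<Rightarrow> bool) \<Rightarrow> 'a set \<Rightarrow> 'a set \<Rightarrow> 'a set" where
  "ideal_star P lt' J1 J2 =
     (\<lambda>J. J \<in> order_ideals P lt') hull ((J1 \<inter> J2) \<inter> (maximals lt' J1 \<union> maximals lt' J2))"

definition dominant :: "'a set \<Rightarrow> ('a \<Rightarrow> 'a \<Rightarrow> bool) \<Rightarrow> ('a \<Rightarrow> int) \<Rightarrow> bool" where
  "dominant M lt lam \<longleftrightarrow> (\<forall>p\<in>M. \<forall>q\<in>M. lt p q \<longrightarrow> lam p \<ge> lam q)"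

definition indicator_vec :: "'a set \<Rightarrow> real ^ 'a" where
  "indicator_vec A = (\<chi> p. indicator A p)"

definition fund_polytope ::
  "'a::finite set \<Rightarrow> 'a set \<Rightarrow> ('a \<Rightarrow> 'a \<Rightarrow> bool) \<Rightarrow> ('a \<Rightarrow> 'a \<Rightarrow> bool) \<Rightarrow> 'a set \<Rightarrow> (real ^ 'a) set" where
  "fund_polytope P M lt lt' K =
     convex hull {indicator_vec (maximals lt' J) | J. J \<in> order_ideals P lt \<and> J \<inter> M = K}"

text \<open>
  The coefficients of the expression of a marking as a combination of indicators of a chain of
  ideals are indexed by all subsets of \<open>'a\<close>; they are required to vanish outside the set of order
  ideals of the marked poset, which makes the coefficient function unique.
\<close>

definition chain_expression ::
  "'a::finite set \<Rightarrow> ('a \<Rightarrow> 'a \<Rightarrow> bool) \<Rightarrow> ('a \<Rightarrow> int) \<Rightarrow> ('a set \<Rightarrow> nat) \<Rightarrow> bool" where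
  "chain_expression M lt lam \<alpha> \<longleftrightarrow>
     (\<forall>K. K \<notin> order_ideals M lt \<longrightarrow> \<alpha> K = 0) \<and>
     \<alpha> {} = 0 \<and>
     chain_subset {K. \<alpha> K > 0} \<and>
     (\<forall>p\<in>M. lam p = (\<Sum>K\<in>order_ideals M lt. int (\<alpha> K) * indicator K p))"

definition chain_coeffs ::
  "'a::finite set \<Rightarrow> ('a \<Rightarrow> 'a \<Rightarrow> bool) \<Rightarrow> ('a \<Rightarrow> int) \<Rightarrow> 'a set \<Rightarrow> nat" where
  "chain_coeffs M lt lam = (THE \<alpha>. chain_expression M lt lam \<alpha>)"

text \<open>The sum of sets below is the Minkowski sum.\<close>

definition nonneg_mrpp ::
  "'a::finite set \<Rightarrow> 'a set \<Rightarrow> ('a \<Rightarrow> 'a \<Rightarrow> bool) \<Rightarrow> ('a \<Rightarrow> 'a \<Rightarrow> bool) \<Rightarrow> ('a \<Rightarrow> int) \<Rightarrow> (real ^ 'a) set" where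
  "nonneg_mrpp P M lt lt' lam =
     (\<Sum>K\<in>order_ideals M lt.
        (\<lambda>x. real (chain_coeffs M lt lam K) *\<^sub>R x) ` fund_polytope P M lt lt' K)"

definition shifted_mrpp ::
  "'a::finite set \<Rightarrow> 'a set \<Rightarrow> ('a \<Rightarrow> 'a \<Rightarrow> bool) \<Rightarrow> ('a \<Rightarrow> 'a \<Rightarrow> bool) \<Rightarrow> ('a \<Rightarrow> int) \<Rightarrow> int \<Rightarrow> (real ^ 'a) set" where
  "shifted_mrpp P M lt lt' lam \<beta> =
     (\<lambda>x. x - of_int \<beta> *\<^sub>R indicator_vec (maximals lt' P)) ` nonneg_mrpp P M lt lt' (\<lambda>p. lam p + \<beta>)"

text \<open>
  The marked relative poset polytope of \<open>(P, lt, lt')\<close> with set of marked elements \<open>M\<close>.  The choice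
  of \<open>\<beta>\<close> is immaterial by lemma \<open>mrpp_eq_shifted\<close> below.
\<close>

definition mrpp ::
  "'a::finite set \<Rightarrow> 'a set \<Rightarrow> ('a \<Rightarrow> 'a \<Rightarrow> bool) \<Rightarrow> ('a \<Rightarrow> 'a \<Rightarrow> bool) \<Rightarrow> ('a \<Rightarrow> int) \<Rightarrow> (real ^ 'a) set" where
  "mrpp P M lt lt' lam = shifted_mrpp P M lt lt' lam (SOME \<beta>. \<forall>p\<in>M. 0 \<le> lam p + \<beta>)"

definition admissible_order ::
  "'a set \<Rightarrow> 'a set \<Rightarrow> ('a \<Rightarrow> 'a \<Rightarrow> bool) \<Rightarrow> ('a \<Rightarrow> 'a \<Rightarrow> bool) \<Rightarrow> bool" where
  "admissible_order P M lt lt' \<longleftrightarrow>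
     strict_order_on P lt' \<and>
     (\<forall>p\<in>P. \<forall>q\<in>P. lt' p q \<longrightarrow> lt p q) \<and>
     (\<forall>J1\<in>order_ideals P lt. \<forall>J2\<in>order_ideals P lt. ideal_star P lt' J1 J2 \<in> order_ideals P lt) \<and>
     (\<forall>p\<in>M. \<forall>q\<in>P. \<not> lt' p q)"

definition integer_points :: "(real ^ 'a) set \<Rightarrow> (real ^ 'a) set" where
  "integer_points Q = {z \<in> Q. \<forall>i. z $ i \<in> \<int>}"

definition lattice_polytope :: "(real ^ 'a::finite) set \<Rightarrow> bool" where
  "lattice_polytope Q \<longleftrightarrow> (\<exists>V. finite V \<and> integer_points V = V \<and> Q = convex hull V)"

definition ehrhart_equivalent :: "(real ^ 'a::finite) set \<Rightarrow> (real ^ 'a) set \<Rightarrow> bool" where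
  "ehrhart_equivalent Q Q' \<longleftrightarrow>
     lattice_polytope Q \<and> lattice_polytope Q' \<and>
     (\<forall>m::nat. card (integer_points ((\<lambda>x. real m *\<^sub>R x) ` Q)) =
               card (integer_points ((\<lambda>x. real m *\<^sub>R x) ` Q')))"

subsection \<open>Well-definedness\<close>

lemma finite_order_ideals [simp]: "finite (order_ideals (P :: 'a::finite set) lt)"
  by simp

lemma chain_expression_support:
  assumes "chain_expression M lt lam \<alpha>"
  shows "\<alpha> K > 0 \<Longrightarrow> K \<in> order_ideals M lt \<and> K \<noteq> {} \<and> K \<subseteq> {p \<in> M. lam p > 0}"
proof -
  assume K: "\<alpha> K > 0"
  have KI: "K \<in> order_ideals M lt"
    using assms K unfolding chain_expression_def by force
  have ne: "K \<noteq> {}"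
    using assms K unfolding chain_expression_def by force
  have "lam p > 0" if p: "p \<in> K" for p
  proof -
    have pM: "p \<in> M" using KI p by (auto simp: order_ideals_def)
    have "(\<Sum>L\<in>order_ideals M lt. int (\<alpha> L) * indicator L p) \<ge> (\<Sum>L\<in>{K}. int (\<alpha> L) * indicator L p)"
      using KI by (intro sum_mono2) auto
    then show ?thesis
      using assms pM K p unfolding chain_expression_def by auto
  qed
  then show ?thesis using KI ne by (auto simp: order_ideals_def)
qed

lemma chain_expression_nonneg:
  assumes "chain_expression M lt lam \<alpha>" "p \<in> M"
  shows "lam p \<ge> 0"
  using assms unfolding chain_expression_def by (auto intro!: sum_nonneg)

lemma chain_expression_top:
  assumes a: "chain_expression M lt lam \<alpha>" and ne: "{p \<in> M. lam p > 0} \<noteq> {}"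
  shows "\<alpha> {p \<in> M. lam p > 0} > 0"
proof -
  let ?T = "{p \<in> M. lam p > 0}" and ?S = "{K. \<alpha> K > 0}"
  have cov: "\<exists>K\<in>?S. p \<in> K" if "p \<in> ?T" for p
  proof (rule ccontr)
    assume "\<not> ?thesis"
    then have "(\<Sum>K\<in>order_ideals M lt. int (\<alpha> K) * indicator K p) = 0"
      by (intro sum.neutral) (auto simp: indicator_def)
    then show False using a that unfolding chain_expression_def by auto
  qed
  have "?S \<noteq> {}" using ne cov by blast
  moreover have "subset.chain UNIV ?S"
    using a unfolding chain_expression_def chain_subset_alt_def by blast
  ultimately have "\<Union>?S \<in> ?S"
    by (intro Union_in_chain) auto
  moreover have "\<Union>?S = ?T"
    using cov chain_expression_support[OF a] by blast
  ultimately show ?thesis by simp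
qed

lemma chain_expression_unique:
  assumes "chain_expression M lt lam \<alpha>" "chain_expression M lt lam \<alpha>'"
  shows "\<alpha> = \<alpha>'"
  using assms
proof (induction "\<Sum>p\<in>M. nat (lam p)" arbitrary: lam \<alpha> \<alpha>' rule: less_induct)
  case less
  let ?T = "{p \<in> M. lam p > 0}"
  show ?case
  proof (cases "?T = {}")
    case True
    have "\<alpha> K = 0" "\<alpha>' K = 0" for K
      using chain_expression_support[OF less.prems(1), of K]
        chain_expression_support[OF less.prems(2), of K] True by fastforce+
    then show ?thesis by auto
  next
    case False
    have red: "chain_expression M lt (\<lambda>p. lam p - indicator ?T p) (\<gamma>(?T := \<gamma> ?T - 1))"
      if g: "chain_expression M lt lam \<gamma>" for \<gamma>
    proof -
      have pos: "\<gamma> ?T > 0" by (rule chain_expression_top[OF g False])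
      have TI: "?T \<in> order_ideals M lt"
        using chain_expression_support[OF g pos] by blast
      have "(\<Sum>K\<in>order_ideals M lt. int ((\<gamma>(?T := \<gamma> ?T - 1)) K) * indicator K p)
          = (\<Sum>K\<in>order_ideals M lt. int (\<gamma> K) * indicator K p) - indicator ?T p" for p
        using TI pos
        by (subst (1 2) sum.remove[of _ ?T]) (auto simp: of_nat_diff algebra_simps)
      moreover have "{K. (\<gamma>(?T := \<gamma> ?T - 1)) K > 0} \<subseteq> {K. \<gamma> K > 0}" by auto
      ultimately show ?thesis
        using g False unfolding chain_expression_def chain_subset_def by (auto split: if_splits)
    qed
    have "(\<Sum>p\<in>M. nat (lam p - indicator ?T p)) < (\<Sum>p\<in>M. nat (lam p))"
      using False by (intro sum_strict_mono_ex1) (auto simp: indicator_def)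
    from less.hyps[OF this red[OF less.prems(1)] red[OF less.prems(2)]]
    have eq: "\<alpha>(?T := \<alpha> ?T - 1) = \<alpha>'(?T := \<alpha>' ?T - 1)" .
    have p1: "\<alpha> ?T > 0" and p2: "\<alpha>' ?T > 0"
      using chain_expression_top less.prems False by blast+
    show ?thesis
    proof
      fix K show "\<alpha> K = \<alpha>' K"
        using fun_cong[OF eq, of K] p1 p2 by (cases "K = ?T") auto
    qed
  qed
qed

lemma chain_expression_exists:
  assumes "dominant M lt lam" "\<forall>p\<in>M. lam p \<ge> 0"
  shows "\<exists>\<alpha>. chain_expression M lt lam \<alpha>"
  using assms
proof (induction "\<Sum>p\<in>M. nat (lam p)" arbitrary: lam rule: less_induct)
  case less
  let ?T = "{p \<in> M. lam p > 0}" and ?l = "\<lambda>p. lam p - indicator {p \<in> M. lam p > 0} p"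
  show ?case
  proof (cases "?T = {}")
    case True
    then have "\<forall>p\<in>M. lam p = 0" using less.prems(2) by force
    then have "chain_expression M lt lam (\<lambda>_. 0)"
      by (auto simp: chain_expression_def chain_subset_def)
    then show ?thesis by blast
  next
    case False
    have "(\<Sum>p\<in>M. nat (?l p)) < (\<Sum>p\<in>M. nat (lam p))"
      using False by (intro sum_strict_mono_ex1) (auto simp: indicator_def)
    moreover have "dominant M lt ?l"
      using less.prems unfolding dominant_def indicator_def by (fastforce simp: not_less)
    moreover have "\<forall>p\<in>M. ?l p \<ge> 0"
      using less.prems(2) by (auto simp: indicator_def)
    ultimately obtain \<gamma> where g: "chain_expression M lt ?l \<gamma>"
      using less.hyps[of ?l] by blast
    have TI: "?T \<in> order_ideals M lt"
      using less.prems unfolding order_ideals_def dominant_def by fastforce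
    have sub: "K \<subseteq> ?T" if "\<gamma> K > 0" for K
    proof -
      have "?l p > 0 \<Longrightarrow> lam p > 0" for p
        by (cases "lam p > 0") (auto simp: indicator_def)
      then show ?thesis using chain_expression_support[OF g that] by blast
    qed
    let ?a = "\<gamma>(?T := \<gamma> ?T + 1)"
    have "(\<Sum>K\<in>order_ideals M lt. int (?a K) * indicator K p)
          = (\<Sum>K\<in>order_ideals M lt. int (\<gamma> K) * indicator K p) + indicator ?T p" for p
      using TI by (subst (1 2) sum.remove[of _ ?T]) (auto simp: algebra_simps)
    moreover have "chain_subset {K. ?a K > 0}"
      using g sub unfolding chain_expression_def chain_subset_def by (auto split: if_splits)
    ultimately have "chain_expression M lt lam ?a"
      using g False TI unfolding chain_expression_def by auto
    then show ?thesis by blast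
  qed
qed

lemma chain_coeffs:
  assumes "dominant M lt lam" "\<forall>p\<in>M. lam p \<ge> 0"
  shows "chain_expression M lt lam (chain_coeffs M lt lam)"
  unfolding chain_coeffs_def
  using chain_expression_exists[OF assms] chain_expression_unique by (metis theI)

lemma chain_coeffs_eqI:
  "chain_expression M lt lam \<alpha> \<Longrightarrow> chain_coeffs M lt lam = \<alpha>"
  unfolding chain_coeffs_def using chain_expression_unique by blast

lemma ideal_eq_carrier:
  fixes P :: "'a::finite set"
  assumes "strict_order_on P lt" "maximals lt P \<subseteq> J" "J \<in> order_ideals P lt"
  shows "J = P"
proof (rule ccontr)
  assume "J \<noteq> P"
  then have ne: "P - J \<noteq> {}" using assms(3) by (auto simp: order_ideals_def)
  have tr: "transp_on (P - J) lt" "asymp_on (P - J) lt"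
    using assms(1) unfolding strict_order_on_def
    by (auto simp: transp_on_def asymp_on_def irreflp_on_def)
  obtain m where m: "m \<in> P - J" "\<forall>x\<in>P - J. x \<noteq> m \<longrightarrow> \<not> lt m x"
    using Finite_Set.bex_max_element[OF _ tr(2) tr(1) ne] by auto
  then obtain q where "q \<in> P" "lt m q"
    using assms(2) by (auto simp: maximals_def)
  moreover from this have "q \<in> J"
    using m assms(1) by (auto simp: strict_order_on_def irreflp_on_def)
  ultimately show False using m assms(3) by (auto simp: order_ideals_def)
qed

lemma fund_polytope_top:
  assumes "strict_order_on P lt" "M \<subseteq> P" "maximals lt P \<subseteq> M"
  shows "fund_polytope P M lt lt' M = {indicator_vec (maximals lt' P)}"
proof -
  have "J \<in> order_ideals P lt \<and> J \<inter> M = M \<longleftrightarrow> J = P" for J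
  proof
    assume "J \<in> order_ideals P lt \<and> J \<inter> M = M"
    then show "J = P"
      using ideal_eq_carrier[OF assms(1)] assms(3) by blast
  qed (use assms(2) in \<open>auto simp: order_ideals_def\<close>)
  then have "{indicator_vec (maximals lt' J) | J. J \<in> order_ideals P lt \<and> J \<inter> M = M}
      = {indicator_vec (maximals lt' P) :: real ^ 'a}" by auto
  then show ?thesis unfolding fund_polytope_def by simp
qed

lemma nonneg_mrpp_add_const:
  assumes P: "strict_order_on P lt" "M \<subseteq> P" "maximals lt P \<subseteq> M"
    and l: "dominant M lt lam" "\<forall>p\<in>M. lam p \<ge> 0"
  shows "nonneg_mrpp P M lt lt' (\<lambda>p. lam p + int n) =
           (\<lambda>x. x + real n *\<^sub>R indicator_vec (maximals lt' P)) ` nonneg_mrpp P M lt lt' lam"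
proof (cases "M = {}")
  case True
  then have "P = {}"
    using ideal_eq_carrier[OF P(1), of "{}"] P(3) by (auto simp: order_ideals_def)
  then have "indicator_vec (maximals lt' P) = (0 :: real ^ 'a)"
    by (simp add: indicator_vec_def maximals_def vec_eq_iff)
  moreover have "chain_coeffs M lt (\<lambda>p. lam p + int n) = chain_coeffs M lt lam"
    unfolding chain_coeffs_def chain_expression_def using True by simp
  ultimately show ?thesis by (simp add: nonneg_mrpp_def)
next
  case False
  define a where "a = chain_coeffs M lt lam"
  have a: "chain_expression M lt lam a"
    unfolding a_def by (rule chain_coeffs[OF l])
  let ?b = "a(M := a M + n)"
  let ?v = "indicator_vec (maximals lt' P) :: real ^ 'a"
  have MI: "M \<in> order_ideals M lt" by (auto simp: order_ideals_def)
  have "(\<Sum>K\<in>order_ideals M lt. int (?b K) * indicator K p)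
        = (\<Sum>K\<in>order_ideals M lt. int (a K) * indicator K p) + int n" if "p \<in> M" for p
    using MI that by (subst (1 2) sum.remove[of _ M]) (auto simp: algebra_simps)
  moreover have "K \<subseteq> M" if "a K > 0" for K
    using chain_expression_support[OF a that] by blast
  then have "chain_subset {K. ?b K > 0}"
    using a unfolding chain_expression_def chain_subset_def by (auto split: if_splits)
  ultimately have "chain_expression M lt (\<lambda>p. lam p + int n) ?b"
    using a False MI unfolding chain_expression_def by auto
  then have b: "chain_coeffs M lt (\<lambda>p. lam p + int n) = ?b"
    by (rule chain_coeffs_eqI)
  let ?S = "\<Sum>K\<in>order_ideals M lt - {M}. (\<lambda>x. real (a K) *\<^sub>R x) ` fund_polytope P M lt lt' K"
  have "nonneg_mrpp P M lt lt' (\<lambda>p. lam p + int n) = {real (a M + n) *\<^sub>R ?v} + ?S"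
    unfolding nonneg_mrpp_def b
    using MI by (subst sum.remove[of _ M]) (auto simp: fund_polytope_top[OF P])
  moreover have "nonneg_mrpp P M lt lt' lam = {real (a M) *\<^sub>R ?v} + ?S"
    unfolding nonneg_mrpp_def a_def[symmetric]
    using MI by (subst sum.remove[of _ M]) (auto simp: fund_polytope_top[OF P])
  moreover have "{c + d} + S = (\<lambda>x. x + d) ` ({c} + S)" for c d :: "real ^ 'a" and S
    by (force simp: set_plus_def)
  ultimately show ?thesis by (simp add: scaleR_add_left)
qed

lemma shifted_mrpp_add:
  assumes P: "strict_order_on P lt" "M \<subseteq> P" "maximals lt P \<subseteq> M"
    and l: "dominant M lt lam" "\<forall>p\<in>M. 0 \<le> lam p + \<beta>"
  shows "shifted_mrpp P M lt lt' lam (\<beta> + int n) = shifted_mrpp P M lt lt' lam \<beta>"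
proof -
  have "dominant M lt (\<lambda>p. lam p + \<beta>)" using l(1) by (auto simp: dominant_def)
  from nonneg_mrpp_add_const[OF P this l(2), of lt' n] show ?thesis
    by (simp add: shifted_mrpp_def image_image add.assoc scaleR_add_left)
qed

lemma mrpp_eq_shifted:
  assumes P: "strict_order_on P lt" "M \<subseteq> P" "maximals lt P \<subseteq> M"
    and l: "dominant M lt lam" "\<forall>p\<in>M. 0 \<le> lam p + \<beta>"
  shows "mrpp P M lt lt' lam = shifted_mrpp P M lt lt' lam \<beta>"
proof -
  define b where "b = (SOME \<beta>. \<forall>p\<in>M. 0 \<le> lam p + \<beta>)"
  have b: "\<forall>p\<in>M. 0 \<le> lam p + b"
    unfolding b_def using l(2) by (rule someI)
  show ?thesis
    using shifted_mrpp_add[OF P l(1) b, of lt' "nat (\<beta> - b)"]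
      shifted_mrpp_add[OF P l(1) l(2), of lt' "nat (b - \<beta>)"]
    unfolding mrpp_def b_def[symmetric] by (cases "b \<le> \<beta>") auto
qed

lemma mrpp_eq_nonneg_mrpp:
  assumes "strict_order_on P lt" "M \<subseteq> P" "maximals lt P \<subseteq> M"
    and "dominant M lt lam" "\<forall>p\<in>M. 0 \<le> lam p"
  shows "mrpp P M lt lt' lam = nonneg_mrpp P M lt lt' lam"
  using mrpp_eq_shifted[OF assms(1-4), of 0] assms(5) by (simp add: shifted_mrpp_def)

end

theory Submission
  imports Defs
begin

text \<open>
  Write \<open>v J\<close> for the indicator of the \<open>lt'\<close>-maximal elements of an ideal \<open>J\<close>.  Comparing
  coordinates gives \<open>v J1 + v J2 = v (J1 * J2) + v (J1 \<union> J2)\<close> with \<open>J1 * J2 \<subseteq> J1 \<inter> J2\<close>, so every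
  nonnegative combination of the \<open>v J\<close> can be straightened to one supported on a chain.  If the sum
  of a chain combination is an integer vector then its coefficients are integers, since a member of
  a chain has a maximal element lying in no smaller member; moreover the sum determines the
  coefficients, since the largest member is generated by the support of the sum.  As marked elements
  are always maximal, \<open>v J\<close> agrees with the indicator of \<open>J\<close> on them, so the value of the combination
  on \<open>M\<close> fixes the total weight of the ideals with a given trace on \<open>M\<close>.  Hence the integer points of
  the \<open>m\<close>-th dilate correspond to the natural-valued functions \<open>f\<close> with chain support satisfying
  \<open>(\<Sum>J. f J * indicator (J \<inter> M)) = m * lam\<close>, a set that does not involve \<open>lt'\<close>.
\<close>

section \<open>Lattice polytopes under Minkowski sums, dilations and translations\<close>

lemma lattice_polytope_iff:
  "lattice_polytope Q \<longleftrightarrow> (\<exists>V. finite V \<and> (\<forall>v\<in>V. \<forall>i. v $ i \<in> \<int>) \<and> Q = convex hull V)"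
  unfolding lattice_polytope_def integer_points_def by blast

text \<open>\<open>{0}\<close> is the zero of Minkowski addition, hence the value of an empty sum of
  polytopes.\<close>

lemma lattice_polytope_zero: "lattice_polytope {0}"
  unfolding lattice_polytope_iff by (rule exI[of _ "{0}"]) auto

lemma lattice_polytope_plus:
  assumes "lattice_polytope Q" "lattice_polytope R"
  shows "lattice_polytope (Q + R)"
proof -
  obtain V W where "finite V" "\<forall>v\<in>V. \<forall>i. v $ i \<in> \<int>" "Q = convex hull V"
    "finite W" "\<forall>v\<in>W. \<forall>i. v $ i \<in> \<int>" "R = convex hull W"
    using assms unfolding lattice_polytope_iff by blast
  then show ?thesis
    unfolding lattice_polytope_iff
    by (intro exI[of _ "V + W"]) (auto simp: convex_hull_set_plus finite_set_plus elim!: set_plus_elim)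
qed

lemma lattice_polytope_sum:
  "(\<And>i. i \<in> I \<Longrightarrow> lattice_polytope (Q i)) \<Longrightarrow> lattice_polytope (\<Sum>i\<in>I. Q i)"
  by (induction I rule: infinite_finite_induct)
    (auto intro: lattice_polytope_zero lattice_polytope_plus)

lemma lattice_polytope_scale:
  assumes "lattice_polytope Q" "c \<in> \<int>"
  shows "lattice_polytope ((\<lambda>x. c *\<^sub>R x) ` Q)"
proof -
  obtain V where "finite V" "\<forall>v\<in>V. \<forall>i. v $ i \<in> \<int>" "Q = convex hull V"
    using assms unfolding lattice_polytope_iff by blast
  then show ?thesis
    unfolding lattice_polytope_iff using assms(2)
    by (intro exI[of _ "(\<lambda>x. c *\<^sub>R x) ` V"]) (auto simp: convex_hull_scaling)
qed

lemma lattice_polytope_translate: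
  assumes "lattice_polytope Q" "\<forall>i. a $ i \<in> \<int>"
  shows "lattice_polytope ((\<lambda>x. x - a) ` Q)"
proof -
  obtain V where "finite V" "\<forall>v\<in>V. \<forall>i. v $ i \<in> \<int>" "Q = convex hull V"
    using assms unfolding lattice_polytope_iff by blast
  moreover have "convex hull ((\<lambda>x. x - a) ` V) = (\<lambda>x. x - a) ` (convex hull V)"
    using convex_hull_translation[of "- a" V] by simp
  ultimately show ?thesis
    unfolding lattice_polytope_iff using assms(2)
    by (intro exI[of _ "(\<lambda>x. x - a) ` V"]) auto
qed

lemma card_integer_points_translate:
  fixes a :: "real ^ 'a::finite"
  assumes "\<forall>i. a $ i \<in> \<int>"
  shows "card (integer_points ((\<lambda>x. x - a) ` Q)) = card (integer_points Q)"
proof -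
  have "z - a \<in> integer_points ((\<lambda>x. x - a) ` Q) \<longleftrightarrow> z \<in> integer_points Q" for z
  proof -
    have "(\<forall>i. (z - a) $ i \<in> \<int>) \<longleftrightarrow> (\<forall>i. z $ i \<in> \<int>)"
      using assms by (metis Ints_add Ints_diff diff_add_cancel vector_minus_component)
    then show ?thesis by (auto simp: integer_points_def)
  qed
  then have "integer_points ((\<lambda>x. x - a) ` Q) = (\<lambda>x. x - a) ` integer_points Q"
    by (auto simp: image_iff) (metis diff_add_cancel add_diff_cancel)+
  then show ?thesis by (simp add: card_image inj_on_def)
qed

lemma indicator_vec_Ints: "indicator_vec A $ i \<in> \<int>"
  by (simp add: indicator_vec_def indicator_def)

lemma indicator_vec_component: "indicator_vec A $ i = (if i \<in> A then 1 else 0)"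
  by (simp add: indicator_vec_def indicator_def)

lemma lattice_polytope_fund_polytope: "lattice_polytope (fund_polytope P M lt lt' K)"
  unfolding lattice_polytope_iff fund_polytope_def
  by (intro exI conjI) (auto simp: indicator_vec_Ints)

lemma lattice_polytope_nonneg_mrpp: "lattice_polytope (nonneg_mrpp P M lt lt' lam)"
  unfolding nonneg_mrpp_def
  by (intro lattice_polytope_sum lattice_polytope_scale lattice_polytope_fund_polytope) simp

section \<open>Convex weights and scaled chain expressions\<close>

lemma sum_of_bool_eq_scaleR:
  fixes f :: "'b \<Rightarrow> 'c::real_vector"
  assumes "finite A" "a \<in> A"
  shows "(\<Sum>b\<in>A. (t * of_bool (b = a)) *\<^sub>R f b) = t *\<^sub>R f a"
proof -
  have "(\<Sum>b\<in>A. (t * of_bool (b = a)) *\<^sub>R f b) = (\<Sum>b\<in>A. if b = a then t *\<^sub>R f a else 0)"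
    by (intro sum.cong) auto
  then show ?thesis using assms by simp
qed

text \<open>Weights are placed on the indices rather than on the points, so that convex combinations
  of vertices become weight functions on ideals.\<close>

lemma convex_hull_image_finite:
  fixes f :: "'b \<Rightarrow> 'c::real_vector"
  assumes "finite A"
  shows "convex hull (f ` A) =
    {\<Sum>a\<in>A. u a *\<^sub>R f a | u. (\<forall>a\<in>A. 0 \<le> u a) \<and> sum u A = (1::real)}" (is "_ = ?R")
proof
  have "f a \<in> ?R" if "a \<in> A" for a
  proof (intro CollectI exI conjI)
    show "f a = (\<Sum>b\<in>A. (1 * of_bool (b = a)) *\<^sub>R f b)"
      using sum_of_bool_eq_scaleR[OF assms that, of 1 f] by simp
    show "(\<Sum>b\<in>A. 1 * of_bool (b = a)) = (1::real)"
      using sum_of_bool_eq_scaleR[OF assms that, of 1 "\<lambda>_. 1::real"] by simp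
  qed simp
  moreover have "convex ?R"
  proof (rule convexI)
    fix x y and s t :: real
    assume "x \<in> ?R" "y \<in> ?R" and st: "0 \<le> s" "0 \<le> t" "s + t = 1"
    then obtain u w where "\<forall>a\<in>A. 0 \<le> u a" "sum u A = 1" "x = (\<Sum>a\<in>A. u a *\<^sub>R f a)"
      "\<forall>a\<in>A. 0 \<le> w a" "sum w A = 1" "y = (\<Sum>a\<in>A. w a *\<^sub>R f a)" by blast
    with st show "s *\<^sub>R x + t *\<^sub>R y \<in> ?R"
      by (intro CollectI exI[of _ "\<lambda>a. s * u a + t * w a"])
        (auto simp: sum.distrib scaleR_add_left scaleR_sum_right simp flip: sum_distrib_left)
  qed
  ultimately show "convex hull (f ` A) \<subseteq> ?R"
    by (intro hull_minimal) auto
  show "?R \<subseteq> convex hull (f ` A)"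
  proof clarify
    fix u :: "'b \<Rightarrow> real" assume "\<forall>a\<in>A. 0 \<le> u a" "sum u A = 1"
    then show "(\<Sum>a\<in>A. u a *\<^sub>R f a) \<in> convex hull (f ` A)"
      using assms by (intro convex_sum[OF _ convex_convex_hull]) (auto simp: hull_inc)
  qed
qed

lemma chain_subset_mono: "chain_subset C \<Longrightarrow> D \<subseteq> C \<Longrightarrow> chain_subset D"
  unfolding chain_subset_def by blast

text \<open>Multiplying the coefficients by \<open>m\<close> keeps the support inside the old chain
  (and empties it for \<open>m = 0\<close>), so dilating a polytope amounts to multiplying its
  marking.\<close>

lemma chain_expression_scale:
  assumes "chain_expression M lt lam \<alpha>"
  shows "chain_expression M lt (\<lambda>p. int m * lam p) (\<lambda>K. m * \<alpha> K)"
proof -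
  have "(\<Sum>K\<in>order_ideals M lt. int (m * \<alpha> K) * indicator K p) =
      int m * (\<Sum>K\<in>order_ideals M lt. int (\<alpha> K) * indicator K p)" for p
    by (simp only: of_nat_mult sum_distrib_left mult.assoc)
  then show ?thesis
    using assms unfolding chain_expression_def chain_subset_def by auto
qed

section \<open>Marked chains, ideals and their maximal elements\<close>

text \<open>The combinatorial side of the bijection. It is the analogue of
  \<open>chain_expression\<close> with ideals of \<open>P\<close> in place of ideals of
  \<open>M\<close>, while the equation is still tested on \<open>M\<close> only. The weight of the
  empty ideal has to be fixed because its vertex is the zero vector.\<close>

definition marked_chains ::
  "'a::finite set \<Rightarrow> 'a set \<Rightarrow> ('a \<Rightarrow> 'a \<Rightarrow> bool) \<Rightarrow> ('a \<Rightarrow> int) \<Rightarrow> ('a set \<Rightarrow> nat) set" where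
  "marked_chains P M lt mu =
    {f. (\<forall>J. J \<notin> order_ideals P lt \<longrightarrow> f J = 0) \<and> f {} = 0 \<and> chain_subset {J. f J > 0} \<and>
      (\<forall>p\<in>M. mu p = (\<Sum>J\<in>order_ideals P lt. int (f J) * indicator J p))}"

locale marked_relative_poset =
  fixes P M :: "'a::finite set" and lt lt' :: "'a \<Rightarrow> 'a \<Rightarrow> bool"
  assumes strict_order: "strict_order_on P lt"
    and marked_subset: "M \<subseteq> P"
    and minimals_marked: "minimals lt P \<subseteq> M"
    and admissible: "admissible_order P M lt lt'"
begin

abbreviation "ideals \<equiv> order_ideals P lt"

abbreviation vertex :: "'a set \<Rightarrow> real ^ 'a" where
  "vertex J \<equiv> indicator_vec (maximals lt' J)"

lemma ideal_weaker: "J \<in> ideals \<Longrightarrow> J \<in> order_ideals P lt'"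
  using admissible unfolding admissible_order_def order_ideals_def by blast

lemma ideal_subset: "J \<in> ideals \<Longrightarrow> J \<subseteq> P"
  by (simp add: order_ideals_def)

lemma Union_ideals: "S \<subseteq> ideals \<Longrightarrow> \<Union>S \<in> ideals"
  unfolding order_ideals_def by blast

lemma vertex_empty: "vertex {} = 0"
  by (simp add: vec_eq_iff indicator_vec_component maximals_def)

text \<open>An ideal is generated under \<open>lt'\<close> by its maximal elements:
  \<open>J \<inter> L\<close> is an \<open>lt'\<close>-ideal of \<open>J\<close> containing all of
  them, hence all of \<open>J\<close>.\<close>

lemma ideal_subset_of_maximals:
  assumes J: "J \<in> ideals" and L: "L \<in> ideals" and sub: "maximals lt' J \<subseteq> L"
  shows "J \<subseteq> L"
proof -
  have "strict_order_on P lt'" using admissible by (simp add: admissible_order_def)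
  then have "strict_order_on J lt'"
    using ideal_subset[OF J]
    by (meson strict_order_on_def irreflp_on_subset transp_on_subset)
  moreover have "J \<inter> L \<in> order_ideals J lt'"
    using ideal_weaker[OF L] ideal_subset[OF J] by (auto simp: order_ideals_def)
  moreover have "maximals lt' J \<subseteq> J \<inter> L"
    using sub by (auto simp: maximals_def)
  ultimately have "J \<inter> L = J" by (intro ideal_eq_carrier)
  then show ?thesis by blast
qed

text \<open>A marked element is never \<open>lt'\<close>-below anything, so it is maximal in every
  ideal containing it.\<close>

lemma mem_maximals_marked: "J \<in> ideals \<Longrightarrow> p \<in> M \<Longrightarrow> p \<in> maximals lt' J \<longleftrightarrow> p \<in> J"
  using admissible ideal_subset[of J] unfolding maximals_def admissible_order_def by blast

text \<open>A minimal element of a nonempty ideal is minimal in \<open>P\<close> and therefore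
  marked. Thus only the empty ideal has empty trace on \<open>M\<close>.\<close>

lemma ideal_unmarked:
  assumes "J \<in> ideals" "J \<inter> M = {}"
  shows "J = {}"
proof (rule ccontr)
  assume "J \<noteq> {}"
  have JP: "J \<subseteq> P" by (rule ideal_subset[OF assms(1)])
  then have "transp_on J lt" "asymp_on J lt"
    using strict_order unfolding strict_order_on_def
    by (meson transp_on_subset irreflp_on_subset asymp_on_iff_irreflp_on_if_transp_on)+
  then obtain m where m: "m \<in> J" "\<forall>x\<in>J. x \<noteq> m \<longrightarrow> \<not> lt x m"
    using Finite_Set.bex_min_element[of J lt] \<open>J \<noteq> {}\<close> finite by metis
  have "m \<in> P" using m(1) JP by blast
  moreover have "\<not> lt q m" if "q \<in> P" for q
  proof
    assume "lt q m"
    then have "q \<in> J" using assms(1) m(1) that by (simp add: order_ideals_def)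
    then have "q = m" using m(2) \<open>lt q m\<close> by blast
    then show False
      using \<open>lt q m\<close> \<open>m \<in> P\<close> strict_order by (simp add: strict_order_on_def irreflp_on_def)
  qed
  ultimately have "m \<in> minimals lt P" by (simp add: minimals_def)
  then show False using minimals_marked assms(2) m(1) by blast
qed

section \<open>The star operation and straightening to chains\<close>

lemma ideal_star_ideal:
  "J1 \<in> ideals \<Longrightarrow> J2 \<in> ideals \<Longrightarrow> ideal_star P lt' J1 J2 \<in> ideals"
  using admissible unfolding admissible_order_def by blast

lemma ideal_star_subset:
  assumes "J1 \<in> ideals" "J2 \<in> ideals"
  shows "ideal_star P lt' J1 J2 \<subseteq> J1 \<inter> J2"
  unfolding ideal_star_def
  using ideal_weaker[OF assms(1)] ideal_weaker[OF assms(2)]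
  by (intro hull_minimal) (auto simp: order_ideals_def)

text \<open>A generator is maximal in \<open>J1\<close> or in \<open>J2\<close>, and the star lies
  inside both, so it stays maximal. Conversely, a maximal element that is not a generator could be
  removed, against the minimality of the hull.\<close>

lemma maximals_ideal_star:
  assumes J: "J1 \<in> ideals" "J2 \<in> ideals"
  shows "maximals lt' (ideal_star P lt' J1 J2) = J1 \<inter> J2 \<inter> (maximals lt' J1 \<union> maximals lt' J2)"
    (is "maximals lt' ?S = ?G")
proof
  have G: "?G \<subseteq> ?S" unfolding ideal_star_def by (rule hull_subset)
  then show "?G \<subseteq> maximals lt' ?S"
    using ideal_star_subset[OF J] by (auto simp: maximals_def)
  show "maximals lt' ?S \<subseteq> ?G"
  proof
    fix p assume p: "p \<in> maximals lt' ?S"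
    show "p \<in> ?G"
    proof (rule ccontr)
      assume "p \<notin> ?G"
      have "?S \<in> order_ideals P lt'" by (intro ideal_weaker ideal_star_ideal J)
      then have "?S - {p} \<in> order_ideals P lt'"
        using p unfolding order_ideals_def maximals_def by blast
      then have "(\<lambda>J. J \<in> order_ideals P lt') hull ?G \<subseteq> ?S - {p}"
        using G \<open>p \<notin> ?G\<close> by (intro hull_minimal) blast+
      then have "?S \<subseteq> ?S - {p}" by (simp only: ideal_star_def)
      then show False using p by (auto simp: maximals_def)
    qed
  qed
qed

text \<open>An element of exactly one \<open>Ji\<close> lies outside the star and is maximal in the
  union iff it is maximal in \<open>Ji\<close>. An element of both is maximal in the star iff it is
  maximal in at least one of them, and in the union iff it is maximal in both.\<close>

lemma vertex_straighten:
  assumes J: "J1 \<in> ideals" "J2 \<in> ideals"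
  shows "vertex J1 + vertex J2 = vertex (ideal_star P lt' J1 J2) + vertex (J1 \<union> J2)"
proof -
  have lower: "q \<in> J \<Longrightarrow> p \<in> J' \<Longrightarrow> lt' p q \<Longrightarrow> p \<in> J"
    if "J \<in> ideals" "J' \<in> ideals" for p q J J'
    using ideal_weaker[OF that(1)] ideal_subset[OF that(2)] unfolding order_ideals_def by blast
  have "(p \<in> maximals lt' (J1 \<union> J2)) \<longleftrightarrow>
      p \<in> maximals lt' J1 \<and> p \<notin> J2 \<or> p \<in> maximals lt' J2 \<and> p \<notin> J1 \<or>
      p \<in> maximals lt' J1 \<and> p \<in> maximals lt' J2" for p
    using lower[OF J] lower[OF J(2,1)] unfolding maximals_def by blast
  moreover have "maximals lt' J1 \<subseteq> J1" "maximals lt' J2 \<subseteq> J2"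
    by (auto simp: maximals_def)
  ultimately show ?thesis
    by (auto simp: vec_eq_iff indicator_vec_component maximals_ideal_star[OF J])
qed

text \<open>
  Among all nonnegative combinations with the same value and total weight, one maximising
  \<open>\<Sum>J. c J * 2 ^ card J\<close> is supported on a chain: shifting weight from incomparable \<open>J1\<close>, \<open>J2\<close> to
  \<open>ideal_star P lt' J1 J2\<close> and \<open>J1 \<union> J2\<close> would increase this functional.
\<close>

lemma chain_combination_exists:
  assumes c0: "\<forall>J\<in>ideals. 0 \<le> c0 J"
  shows "\<exists>c::'a set \<Rightarrow> real. (\<forall>J. 0 \<le> c J) \<and> (\<forall>J. J \<notin> ideals \<longrightarrow> c J = 0) \<and> c {} = 0 \<and>
    chain_subset {J. c J > 0} \<and> (\<Sum>J\<in>ideals. c J *\<^sub>R vertex J) = (\<Sum>J\<in>ideals. c0 J *\<^sub>R vertex J)"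
proof -
  define x where "x = (\<Sum>J\<in>ideals. c0 J *\<^sub>R vertex J)"
  \<comment> \<open>Fixing the total weight makes \<open>S\<close> bounded; the value alone would
    not, since the empty ideal contributes 0 with any coefficient.\<close>
  define N where "N = (\<Sum>J\<in>ideals. c0 J)"
  define S where "S = {c::real^('a set). (\<forall>J. 0 \<le> c $ J) \<and> (\<forall>J. J \<notin> ideals \<longrightarrow> c $ J = 0) \<and>
    (\<Sum>J\<in>ideals. c $ J) = N \<and> (\<Sum>J\<in>ideals. c $ J *\<^sub>R vertex J) = x}"
  let ?\<phi> = "\<lambda>c::real^('a set). \<Sum>J\<in>ideals. c $ J * 2 ^ card J"
  have "(\<chi> J. if J \<in> ideals then c0 J else 0) \<in> S"
    using c0 by (auto simp: S_def x_def N_def)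
  then have ne: "S \<noteq> {}" by blast
  have "S = (\<Inter>J. {c. 0 \<le> c $ J}) \<inter> (\<Inter>J\<in>- ideals. {c. c $ J = 0}) \<inter>
      {c. (\<Sum>J\<in>ideals. c $ J) = N} \<inter> {c. (\<Sum>J\<in>ideals. c $ J *\<^sub>R vertex J) = x}"
    unfolding S_def by auto
  then have "closed S"
    by (auto intro!: closed_Int closed_INT closed_Collect_le closed_Collect_eq continuous_intros)
  moreover have "bounded S"
  proof -
    have "norm c \<le> (\<Sum>J\<in>(UNIV :: 'a set set). \<bar>N\<bar>)" if "c \<in> S" for c
    proof -
      have le: "\<bar>c $ J\<bar> \<le> \<bar>N\<bar>" for J
      proof (cases "J \<in> ideals")
        case True
        then have "c $ J \<le> N"
          using that member_le_sum[of J ideals "\<lambda>J. c $ J"] by (auto simp: S_def)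
        then show ?thesis using that by (auto simp: S_def)
      qed (use that in \<open>auto simp: S_def\<close>)
      have "(\<Sum>J\<in>UNIV. \<bar>c $ J\<bar>) \<le> (\<Sum>J\<in>(UNIV :: 'a set set). \<bar>N\<bar>)"
        by (intro sum_mono le)
      with norm_le_l1_cart show ?thesis by (rule order_trans)
    qed
    then show ?thesis unfolding bounded_iff by blast
  qed
  ultimately have "compact S" by (simp add: compact_eq_bounded_closed)
  moreover have "continuous_on S ?\<phi>" by (intro continuous_intros)
  ultimately obtain c where c: "c \<in> S" and max: "\<And>d. d \<in> S \<Longrightarrow> ?\<phi> d \<le> ?\<phi> c"
    using continuous_attains_sup[OF _ ne] by blast
  have c_nonneg: "\<And>J. 0 \<le> c $ J" and c_zero: "\<And>J. J \<notin> ideals \<Longrightarrow> c $ J = 0"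
    and c_weight: "(\<Sum>J\<in>ideals. c $ J) = N" and c_value: "(\<Sum>J\<in>ideals. c $ J *\<^sub>R vertex J) = x"
    using c unfolding S_def by blast+
  have "J1 \<subseteq> J2 \<or> J2 \<subseteq> J1" if pos: "c $ J1 > 0" "c $ J2 > 0" for J1 J2
  proof (rule ccontr)
    assume incomp: "\<not> (J1 \<subseteq> J2 \<or> J2 \<subseteq> J1)"
    have J: "J1 \<in> ideals" "J2 \<in> ideals"
      using c_zero pos by (metis less_irrefl)+
    define A where "A = ideal_star P lt' J1 J2"
    define B where "B = J1 \<union> J2"
    define \<epsilon> where "\<epsilon> = min (c $ J1) (c $ J2)"
    define d :: "real^('a set)" where
      "d = (\<chi> J. c $ J + \<epsilon> * of_bool (J = A) + \<epsilon> * of_bool (J = B)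
                         - \<epsilon> * of_bool (J = J1) - \<epsilon> * of_bool (J = J2))"
    have eps: "\<epsilon> > 0" "\<epsilon> \<le> c $ J1" "\<epsilon> \<le> c $ J2" using pos by (auto simp: \<epsilon>_def)
    have AB: "A \<in> ideals" "B \<in> ideals"
      using ideal_star_ideal[OF J] J Union_ideals[of "{J1, J2}"] by (auto simp: A_def B_def)
    note delta = sum_of_bool_eq_scaleR[OF finite_order_ideals]
    \<comment> \<open>General in \<open>g\<close> because it is applied to the total weight, to the
      value and to the functional \<open>?\<phi>\<close>.\<close>
    have d_sum: "(\<Sum>J\<in>ideals. d $ J *\<^sub>R g J) =
        (\<Sum>J\<in>ideals. c $ J *\<^sub>R g J) + \<epsilon> *\<^sub>R g A + \<epsilon> *\<^sub>R g B - \<epsilon> *\<^sub>R g J1 - \<epsilon> *\<^sub>R g J2"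
      for g :: "'a set \<Rightarrow> 'c::real_vector"
      unfolding d_def vec_lambda_beta scaleR_add_left scaleR_diff_left sum.distrib sum_subtractf
        delta[OF AB(1)] delta[OF AB(2)] delta[OF J(1)] delta[OF J(2)] ..
    \<comment> \<open>Distinctness ensures that \<open>\<epsilon>\<close> is subtracted at most once
      from any coefficient.\<close>
    have ne12: "J1 \<noteq> J2" using incomp by blast
    have "d \<in> S"
    proof -
      have "0 \<le> d $ J" for J
        using c_nonneg[of J] eps ne12 by (auto simp: d_def of_bool_def)
      moreover have "d $ J = 0" if "J \<notin> ideals" for J
      proof -
        have "J \<noteq> A" "J \<noteq> B" "J \<noteq> J1" "J \<noteq> J2" using that J AB by blast+
        then show ?thesis using c_zero[OF that] by (simp add: d_def)
      qed
      moreover have "(\<Sum>J\<in>ideals. d $ J) = N"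
        using d_sum[of "\<lambda>_. 1::real"] c_weight by simp
      moreover have "(\<Sum>J\<in>ideals. d $ J *\<^sub>R vertex J) = x"
      proof -
        have "\<epsilon> *\<^sub>R vertex A + \<epsilon> *\<^sub>R vertex B = \<epsilon> *\<^sub>R vertex J1 + \<epsilon> *\<^sub>R vertex J2"
          unfolding A_def B_def by (simp only: vertex_straighten[OF J] flip: scaleR_add_right)
        then show ?thesis
          unfolding d_sum c_value by (simp only: add.assoc diff_diff_eq add_diff_cancel_right')
      qed
      ultimately show ?thesis unfolding S_def by blast
    qed
    have "J1 \<subset> B" "J2 \<subset> B" using incomp by (auto simp: B_def)
    then have "card J1 < card B" "card J2 < card B" by (simp_all add: psubset_card_mono)
    \<comment> \<open>Base 2 lets the union alone outweigh \<open>J1\<close> and \<open>J2\<close>: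
      averaging the two bounds gives \<open>2 ^ card B \<ge> 2 ^ card J1 + 2 ^ card J2\<close>. The
      positive term for \<open>A\<close> makes the inequality strict, however small \<open>A\<close>
      is.\<close>
    then have "(2::real) ^ Suc (card J1) \<le> 2 ^ card B" "(2::real) ^ Suc (card J2) \<le> 2 ^ card B"
      by (intro power_increasing; simp)+
    then have "(2::real) ^ card A + 2 ^ card B - 2 ^ card J1 - 2 ^ card J2 > 0"
      using zero_less_power[of "2::real" "card A"] unfolding power_Suc by linarith
    from mult_pos_pos[OF eps(1) this] have "?\<phi> d > ?\<phi> c"
      using d_sum[of "\<lambda>J. 2 ^ card J :: real"] by (simp add: algebra_simps)
    then show False using max[OF \<open>d \<in> S\<close>] by simp
  qed
  then have chain: "chain_subset {J. c $ J > 0}" unfolding chain_subset_def by blast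
  \<comment> \<open>Dropping the weight of the empty ideal does not change the value, because its
    vertex is 0.\<close>
  let ?c = "\<lambda>J. if J = {} then 0 else c $ J"
  have "(\<Sum>J\<in>ideals. ?c J *\<^sub>R vertex J) = (\<Sum>J\<in>ideals. c $ J *\<^sub>R vertex J)"
    by (intro sum.cong) (auto simp: vertex_empty)
  moreover have "chain_subset {J. ?c J > 0}"
    using chain unfolding chain_subset_def by simp
  ultimately show ?thesis
    using c_nonneg c_zero c_value by (intro exI[of _ ?c] conjI) (simp_all add: x_def)
qed

section \<open>Integrality and uniqueness of chain combinations\<close>

lemma combination_component:
  "(\<Sum>J\<in>ideals. c J *\<^sub>R vertex J) $ p = (\<Sum>J\<in>{J \<in> ideals. p \<in> maximals lt' J}. c J)"
proof -
  have "(\<Sum>J\<in>ideals. c J *\<^sub>R vertex J) $ p = (\<Sum>J\<in>ideals. if p \<in> maximals lt' J then c J else 0)"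
    unfolding sum_component by (intro sum.cong) (auto simp: indicator_vec_component)
  then show ?thesis by (simp only: sum.inter_filter finite_order_ideals)
qed

text \<open>Induction from the largest member of the chain downwards. At a maximal element
  \<open>p\<close> of \<open>J\<close> lying in no smaller member, the coordinate of the sum is
  \<open>c J\<close> plus coefficients of larger members, which are already integers.\<close>

lemma chain_combination_integral:
  assumes c: "\<forall>J. 0 \<le> c J" "\<forall>J. J \<notin> ideals \<longrightarrow> c J = 0" "c {} = 0"
    and chain: "chain_subset {J. c J > 0}"
    and int: "\<forall>p. (\<Sum>J\<in>ideals. c J *\<^sub>R vertex J) $ p \<in> \<int>"
  shows "c J \<in> \<int>"
proof (induction "card (UNIV - J)" arbitrary: J rule: less_induct)
  case less
  show ?case
  proof (cases "c J = 0")
    case False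
    then have J: "J \<in> ideals" "c J > 0" "J \<noteq> {}" using c by (auto simp: less_le)
    let ?S = "{L. c L > 0 \<and> L \<subset> J}"
    \<comment> \<open>A finite nonempty chain contains its union, but every member of
      \<open>?S\<close> is a proper subset of \<open>J\<close>. Since \<open>\<Union>?S\<close> is
      an ideal not containing \<open>J\<close>, some maximal element of \<open>J\<close> avoids
      it.\<close>
    have "\<Union>?S \<noteq> J"
    proof
      assume eq: "\<Union>?S = J"
      then have "?S \<noteq> {}" using J by auto
      moreover have "subset.chain UNIV ?S"
        using chain unfolding chain_subset_alt_def[symmetric] chain_subset_def by blast
      ultimately have "\<Union>?S \<in> ?S" by (intro Union_in_chain) auto
      then show False using eq by auto
    qed
    moreover have "?S \<subseteq> ideals" using c(2) by force
    then have "maximals lt' J \<subseteq> \<Union>?S \<Longrightarrow> J \<subseteq> \<Union>?S"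
      by (rule ideal_subset_of_maximals[OF J(1) Union_ideals])
    ultimately obtain p where p: "p \<in> maximals lt' J" "p \<notin> \<Union>?S" by blast
    let ?T = "{L \<in> ideals. p \<in> maximals lt' L}"
    have rest: "c L \<in> \<int>" if L: "L \<in> ?T - {J}" for L
    proof (cases "c L = 0")
      case False
      then have "c L > 0" using c(1) by (auto simp: less_le)
      then have "L \<subseteq> J \<or> J \<subseteq> L" using chain J by (auto simp: chain_subset_def)
      moreover have "\<not> L \<subset> J" using p(2) L \<open>c L > 0\<close> by (auto simp: maximals_def)
      ultimately have "J \<subset> L" using L by blast
      then have "card (UNIV - L) < card (UNIV - J)" by (intro psubset_card_mono) auto
      then show ?thesis by (rule less.hyps)
    qed simp
    have "c J + (\<Sum>L\<in>?T - {J}. c L) = (\<Sum>L\<in>?T. c L)"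
      using J p by (intro sum.remove[symmetric]) auto
    also have "\<dots> \<in> \<int>" using int unfolding combination_component by blast
    finally have "c J + (\<Sum>L\<in>?T - {J}. c L) \<in> \<int>" .
    moreover have "(\<Sum>L\<in>?T - {J}. c L) \<in> \<int>" by (intro Ints_sum rest)
    ultimately show ?thesis using Ints_diff by fastforce
  qed simp
qed

text \<open>With nonnegative coefficients nothing cancels: a maximal element of a member of the
  support of \<open>f\<close> has a positive coordinate in the common value, hence lies in a member
  of the support of \<open>g\<close>. The union of those members is an ideal, so it absorbs the
  whole member.\<close>

lemma support_Union_mono:
  fixes f g :: "'a set \<Rightarrow> nat"
  assumes f: "\<forall>J. J \<notin> ideals \<longrightarrow> f J = 0" and g: "\<forall>J. J \<notin> ideals \<longrightarrow> g J = 0"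
    and eq: "(\<Sum>J\<in>ideals. real (f J) *\<^sub>R vertex J) = (\<Sum>J\<in>ideals. real (g J) *\<^sub>R vertex J)"
  shows "\<Union>{J. f J > 0} \<subseteq> \<Union>{J. g J > 0}"
proof (rule Union_least)
  fix J assume "J \<in> {J. f J > 0}"
  then have J: "f J > 0" "J \<in> ideals" using f by force+
  have "{J. g J > 0} \<subseteq> ideals" using g by force
  moreover have "maximals lt' J \<subseteq> \<Union>{J. g J > 0}"
  proof
    fix p assume p: "p \<in> maximals lt' J"
    have "real (f J) \<le> (\<Sum>L\<in>{L \<in> ideals. p \<in> maximals lt' L}. real (f L))"
      using J p by (intro member_le_sum) auto
    then have "(\<Sum>L\<in>{L \<in> ideals. p \<in> maximals lt' L}. real (g L)) \<noteq> 0"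
      using J arg_cong[OF eq, of "\<lambda>x. x $ p"] unfolding combination_component by simp
    then obtain L where "L \<in> ideals" "p \<in> maximals lt' L" "g L \<noteq> 0"
      by (auto elim: sum.not_neutral_contains_not_neutral)
    then show "p \<in> \<Union>{J. g J > 0}" by (auto simp: maximals_def)
  qed
  ultimately show "J \<subseteq> \<Union>{J. g J > 0}"
    by (rule ideal_subset_of_maximals[OF J(2) Union_ideals])
qed

text \<open>The value determines the union of the support, which for a nonempty chain is its largest
  member \<open>T\<close>. Removing one copy of \<open>T\<close> from both sides lowers the total
  weight.\<close>

lemma chain_combination_unique:
  fixes f g :: "'a set \<Rightarrow> nat"
  assumes "\<forall>J. J \<notin> ideals \<longrightarrow> f J = 0" "f {} = 0" "chain_subset {J. f J > 0}"
    and "\<forall>J. J \<notin> ideals \<longrightarrow> g J = 0" "g {} = 0" "chain_subset {J. g J > 0}"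
    and "(\<Sum>J\<in>ideals. real (f J) *\<^sub>R vertex J) = (\<Sum>J\<in>ideals. real (g J) *\<^sub>R vertex J)"
  shows "f = g"
  using assms
proof (induction "sum f ideals" arbitrary: f g rule: less_induct)
  case less
  define T where "T = \<Union>{J. f J > 0}"
  have T: "\<Union>{J. g J > 0} = T"
    unfolding T_def
    by (rule equalityI[OF support_Union_mono[OF less.prems(4,1) less.prems(7)[symmetric]]
          support_Union_mono[OF less.prems(1,4,7)]])
  show ?case
  proof (cases "T = {}")
    case True
    have "h J = 0" if "h {} = 0" "\<Union>{J. h J > 0} = {}" for h :: "'a set \<Rightarrow> nat" and J
      using that by (cases "J = {}") auto
    note zero = this
    show ?thesis
      by (rule ext) (metis zero less.prems(2,5) T T_def True)
  next
    case False
    have top: "h T > 0" if "chain_subset {J. h J > 0}" "\<Union>{J. h J > 0} = T" for h :: "'a set \<Rightarrow> nat"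
    proof -
      have "{J. h J > 0} \<noteq> {}" using that(2) False by auto
      then have "\<Union>{J. h J > 0} \<in> {J. h J > 0}"
        using that(1) unfolding chain_subset_alt_def by (intro Union_in_chain[of _ UNIV]) auto
      then show ?thesis using that(2) by simp
    qed
    have f: "f T > 0" by (rule top[OF less.prems(3) T_def[symmetric]])
    have g: "g T > 0" by (rule top[OF less.prems(6) T])
    have TI: "T \<in> ideals" using f less.prems(1) by force
    let ?dec = "\<lambda>h::'a set \<Rightarrow> nat. h(T := h T - 1)"
    have dec_sum: "(\<Sum>J\<in>ideals. real (?dec h J) *\<^sub>R vertex J) =
        (\<Sum>J\<in>ideals. real (h J) *\<^sub>R vertex J) - vertex T" if "h T > 0" for h
      using TI that by (subst (1 2) sum.remove[of _ T]) (auto simp: of_nat_diff algebra_simps)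
    have dec_chain: "chain_subset {J. ?dec h J > 0}" if "chain_subset {J. h J > 0}"
      for h :: "'a set \<Rightarrow> nat"
      using that unfolding chain_subset_def by (auto split: if_splits)
    have "sum (?dec f) ideals < sum f ideals"
      using TI f by (intro sum_strict_mono_ex1) auto
    then have eq: "?dec f = ?dec g"
    proof (rule less.hyps)
      show "(\<Sum>J\<in>ideals. real (?dec f J) *\<^sub>R vertex J) = (\<Sum>J\<in>ideals. real (?dec g J) *\<^sub>R vertex J)"
        unfolding dec_sum[of f, OF f] dec_sum[of g, OF g] less.prems(7) ..
    qed (use less.prems(1,2,4,5) False dec_chain[OF less.prems(3)] dec_chain[OF less.prems(6)] in auto)
    show ?thesis
    proof
      fix J show "f J = g J"
        using fun_cong[OF eq, of J] f g by (cases "J = T") auto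
    qed
  qed
qed

section \<open>Dilated polytopes as sets of weighted sums over ideals\<close>

lemma fund_polytope_eq:
  "fund_polytope P M lt lt' K = convex hull (vertex ` {J \<in> ideals. J \<inter> M = K})"
  unfolding fund_polytope_def by (rule arg_cong[where f = "\<lambda>S. convex hull S"]) auto

lemma restrict_ideal: "J \<in> ideals \<Longrightarrow> J \<inter> M \<in> order_ideals M lt"
  using marked_subset unfolding order_ideals_def by blast

text \<open>The witness is the \<open>lt\<close>-ideal of \<open>P\<close> generated by
  \<open>K\<close>; its trace is \<open>K\<close> since \<open>K\<close> is already a lower set in
  \<open>M\<close>. In particular no fundamental polytope is empty.\<close>

lemma extend_ideal:
  assumes K: "K \<in> order_ideals M lt"
  shows "\<exists>J\<in>ideals. J \<inter> M = K"
proof -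
  let ?J = "{p \<in> P. p \<in> K \<or> (\<exists>q\<in>K. lt p q)}"
  have "K \<subseteq> M" using K by (simp add: order_ideals_def)
  then have KP: "K \<subseteq> P" using marked_subset by blast
  have trans: "lt p r" if "lt p q" "lt q r" "p \<in> P" "q \<in> P" "r \<in> P" for p q r
    using strict_order that unfolding strict_order_on_def transp_on_def by blast
  have "p \<in> ?J" if q: "q \<in> ?J" and p: "p \<in> P" "lt p q" for p q
  proof (cases "q \<in> K")
    case False
    then obtain r where "r \<in> K" "lt q r" using q by blast
    then show ?thesis using trans[of p q r] q p KP by blast
  qed (use p in blast)
  then have "?J \<in> ideals" unfolding order_ideals_def by blast
  moreover have "?J \<inter> M = K"
    using K marked_subset \<open>K \<subseteq> M\<close> unfolding order_ideals_def by blast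
  ultimately show ?thesis by blast
qed

lemma sum_ideals_fibres:
  "(\<Sum>J\<in>ideals. h J) = (\<Sum>K\<in>order_ideals M lt. \<Sum>J\<in>{J \<in> ideals. J \<inter> M = K}. h J)"
  by (rule sum.group[symmetric]) (auto simp: restrict_ideal)

text \<open>The fibres of \<open>J \<mapsto> J \<inter> M\<close> partition the ideals, so separate
  convex weights for the Minkowski summands merge into one weight function with prescribed total on
  each fibre.\<close>

lemma scaled_nonneg_mrpp:
  "(\<lambda>x. real m *\<^sub>R x) ` nonneg_mrpp P M lt lt' lam =
    {\<Sum>J\<in>ideals. c J *\<^sub>R vertex J | c. (\<forall>J\<in>ideals. 0 \<le> c J) \<and>
      (\<forall>K\<in>order_ideals M lt. (\<Sum>J\<in>{J \<in> ideals. J \<inter> M = K}. c J) = real (m * chain_coeffs M lt lam K))}"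
  (is "?L = ?R")
proof
  let ?\<alpha> = "chain_coeffs M lt lam" and ?F = "\<lambda>K. {J \<in> ideals. J \<inter> M = K}"
  have mem: "x \<in> ?L \<longleftrightarrow> (\<exists>y. (\<forall>K\<in>order_ideals M lt. y K \<in> fund_polytope P M lt lt' K) \<and>
      x = (\<Sum>K\<in>order_ideals M lt. real (m * ?\<alpha> K) *\<^sub>R y K))" for x
  proof
    assume "x \<in> ?L"
    then obtain s where s: "\<forall>K\<in>order_ideals M lt. s K \<in> (\<lambda>x. real (?\<alpha> K) *\<^sub>R x) ` fund_polytope P M lt lt' K"
      and x: "x = real m *\<^sub>R sum s (order_ideals M lt)"
      unfolding nonneg_mrpp_def set_sum_alt[OF finite_order_ideals] by blast
    from s have "\<forall>K\<in>order_ideals M lt. \<exists>y. y \<in> fund_polytope P M lt lt' K \<and> s K = real (?\<alpha> K) *\<^sub>R y"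
      by blast
    then obtain y where y: "\<forall>K\<in>order_ideals M lt. y K \<in> fund_polytope P M lt lt' K \<and> s K = real (?\<alpha> K) *\<^sub>R y K"
      by metis
    have "x = (\<Sum>K\<in>order_ideals M lt. real (m * ?\<alpha> K) *\<^sub>R y K)"
      unfolding x scaleR_sum_right by (rule sum.cong) (use y in auto)
    with y show "\<exists>y. (\<forall>K\<in>order_ideals M lt. y K \<in> fund_polytope P M lt lt' K) \<and>
      x = (\<Sum>K\<in>order_ideals M lt. real (m * ?\<alpha> K) *\<^sub>R y K)" by blast
  next
    assume "\<exists>y. (\<forall>K\<in>order_ideals M lt. y K \<in> fund_polytope P M lt lt' K) \<and>
      x = (\<Sum>K\<in>order_ideals M lt. real (m * ?\<alpha> K) *\<^sub>R y K)"
    then obtain y where y: "\<forall>K\<in>order_ideals M lt. y K \<in> fund_polytope P M lt lt' K"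
      and x: "x = real m *\<^sub>R (\<Sum>K\<in>order_ideals M lt. real (?\<alpha> K) *\<^sub>R y K)"
      by (auto simp: scaleR_sum_right)
    then show "x \<in> ?L"
      unfolding nonneg_mrpp_def set_sum_alt[OF finite_order_ideals] by blast
  qed
  show "?L \<subseteq> ?R"
  proof
    fix x assume "x \<in> ?L"
    then obtain y where y: "\<forall>K\<in>order_ideals M lt. y K \<in> fund_polytope P M lt lt' K"
      and x: "x = (\<Sum>K\<in>order_ideals M lt. real (m * ?\<alpha> K) *\<^sub>R y K)"
      unfolding mem by blast
    have "\<forall>K\<in>order_ideals M lt. \<exists>u. (\<forall>J\<in>?F K. 0 \<le> u J) \<and> sum u (?F K) = (1::real) \<and> y K = (\<Sum>J\<in>?F K. u J *\<^sub>R vertex J)"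
    proof
      fix K assume K: "K \<in> order_ideals M lt"
      have "finite (?F K)" by simp
      from convex_hull_image_finite[OF this, of vertex]
      show "\<exists>u. (\<forall>J\<in>?F K. 0 \<le> u J) \<and> sum u (?F K) = (1::real) \<and> y K = (\<Sum>J\<in>?F K. u J *\<^sub>R vertex J)"
        using bspec[OF y K] unfolding fund_polytope_eq by blast
    qed
    then obtain u where u: "\<forall>K\<in>order_ideals M lt. (\<forall>J\<in>?F K. 0 \<le> u K J) \<and>
        sum (u K) (?F K) = (1::real) \<and> y K = (\<Sum>J\<in>?F K. u K J *\<^sub>R vertex J)"
      by (rule bchoice[THEN exE])
    \<comment> \<open>Each ideal belongs to the single fibre over \<open>J \<inter> M\<close>, whose
      convex weights are scaled to the total of that fibre.\<close>
    define c where "c J = real (m * ?\<alpha> (J \<inter> M)) * u (J \<inter> M) J" for J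
    have "0 \<le> c J" if "J \<in> ideals" for J
      using bspec[OF u restrict_ideal[OF that]] that by (simp add: c_def)
    moreover have "sum c (?F K) = real (m * ?\<alpha> K)" if "K \<in> order_ideals M lt" for K
    proof -
      have "sum c (?F K) = (\<Sum>J\<in>?F K. real (m * ?\<alpha> K) * u K J)"
        by (rule sum.cong) (auto simp: c_def)
      then show ?thesis using bspec[OF u that] by (simp flip: sum_distrib_left)
    qed
    moreover have "x = (\<Sum>J\<in>ideals. c J *\<^sub>R vertex J)"
      unfolding x sum_ideals_fibres
    proof (rule sum.cong[OF refl])
      fix K assume K: "K \<in> order_ideals M lt"
      have "(\<Sum>J\<in>?F K. c J *\<^sub>R vertex J) = (\<Sum>J\<in>?F K. real (m * ?\<alpha> K) *\<^sub>R (u K J *\<^sub>R vertex J))"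
        by (rule sum.cong) (auto simp: c_def)
      also have "\<dots> = real (m * ?\<alpha> K) *\<^sub>R y K"
        using bspec[OF u K] by (simp only: scaleR_sum_right)
      finally show "real (m * ?\<alpha> K) *\<^sub>R y K = (\<Sum>J\<in>?F K. c J *\<^sub>R vertex J)" ..
    qed
    ultimately show "x \<in> ?R" by blast
  qed
  show "?R \<subseteq> ?L"
  proof clarify
    fix c :: "'a set \<Rightarrow> real"
    assume nonneg: "\<forall>J\<in>ideals. 0 \<le> c J"
      and weight: "\<forall>K\<in>order_ideals M lt. sum c (?F K) = real (m * ?\<alpha> K)"
    have fibre: "\<exists>y. y \<in> fund_polytope P M lt lt' K \<and> (\<Sum>J\<in>?F K. c J *\<^sub>R vertex J) = real (m * ?\<alpha> K) *\<^sub>R y"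
      if K: "K \<in> order_ideals M lt" for K
    proof (cases "m * ?\<alpha> K = 0")
      case True
      \<comment> \<open>Normalising is impossible here, but all weights on the fibre vanish and any
        point of the nonempty polytope can be taken for \<open>y\<close>.\<close>
      then have "sum c (?F K) = 0" using weight K by (metis of_nat_0)
      then have "\<forall>J\<in>?F K. c J = 0"
        using nonneg by (subst (asm) sum_nonneg_eq_0_iff) auto
      then have "(\<Sum>J\<in>?F K. c J *\<^sub>R vertex J) = 0" by (intro sum.neutral) simp
      moreover obtain J where "J \<in> ?F K" using extend_ideal[OF K] by blast
      then have "vertex J \<in> fund_polytope P M lt lt' K"
        unfolding fund_polytope_eq by (intro hull_inc imageI)
      moreover have "real (m * ?\<alpha> K) = 0" using True by (simp only: of_nat_0)
      ultimately show ?thesis by (metis scaleR_zero_left)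
    next
      case False
      define a where "a = real (m * ?\<alpha> K)"
      have a: "a > 0" "sum c (?F K) = a" using False weight K by (simp_all add: a_def)
      have "(\<Sum>J\<in>?F K. (c J / a) *\<^sub>R vertex J) \<in> convex hull (vertex ` ?F K)"
      proof (intro convex_sum[OF _ convex_convex_hull])
        show "(\<Sum>J\<in>?F K. c J / a) = 1" using a by (simp flip: sum_divide_distrib)
      qed (use nonneg a in \<open>auto intro: hull_inc\<close>)
      moreover have "(\<Sum>J\<in>?F K. c J *\<^sub>R vertex J) = a *\<^sub>R (\<Sum>J\<in>?F K. (c J / a) *\<^sub>R vertex J)"
        using a(1) by (simp add: scaleR_sum_right)
      ultimately show ?thesis unfolding fund_polytope_eq a_def by blast
    qed
    have "\<forall>K\<in>order_ideals M lt. \<exists>y. y \<in> fund_polytope P M lt lt' K \<and>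
        (\<Sum>J\<in>?F K. c J *\<^sub>R vertex J) = real (m * ?\<alpha> K) *\<^sub>R y"
      by (intro ballI fibre)
    then obtain y where y: "\<forall>K\<in>order_ideals M lt. y K \<in> fund_polytope P M lt lt' K \<and>
        (\<Sum>J\<in>?F K. c J *\<^sub>R vertex J) = real (m * ?\<alpha> K) *\<^sub>R y K"
      by (rule bchoice[THEN exE])
    have "(\<Sum>J\<in>ideals. c J *\<^sub>R vertex J) = (\<Sum>K\<in>order_ideals M lt. real (m * ?\<alpha> K) *\<^sub>R y K)"
      unfolding sum_ideals_fibres by (rule sum.cong[OF refl]) (use y in blast)
    then show "(\<Sum>J\<in>ideals. c J *\<^sub>R vertex J) \<in> ?L"
      unfolding mem using y by blast
  qed
qed

section \<open>Marked coordinates and the bijection with integer points\<close>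

lemma combination_marked:
  assumes "p \<in> M"
  shows "(\<Sum>J\<in>ideals. c J *\<^sub>R vertex J) $ p = (\<Sum>J\<in>ideals. c J * indicator J p)"
  unfolding sum_component
  by (intro sum.cong) (use assms in \<open>auto simp: indicator_vec_component mem_maximals_marked indicator_def\<close>)

text \<open>At a marked \<open>p\<close> the indicator depends only on the trace
  \<open>J \<inter> M\<close>. Both integer and real weights occur below.\<close>

lemma marked_sum_fibres:
  fixes c :: "'a set \<Rightarrow> 'b::comm_ring_1"
  assumes "p \<in> M"
  shows "(\<Sum>J\<in>ideals. c J * indicator J p) =
    (\<Sum>K\<in>order_ideals M lt. (\<Sum>J\<in>{J \<in> ideals. J \<inter> M = K}. c J) * indicator K p)"
  unfolding sum_ideals_fibres sum_distrib_right
  by (intro sum.cong) (use assms in \<open>auto simp: indicator_def\<close>)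

text \<open>Traces on \<open>M\<close> of a chain again form a chain, so the fibre sums of
  \<open>f\<close> are a chain expression of \<open>mu\<close>; uniqueness identifies them with
  \<open>\<beta>\<close>.\<close>

lemma marked_chain_fibre_sums:
  assumes f: "f \<in> marked_chains P M lt mu"
    and \<beta>: "chain_expression M lt mu \<beta>" and K: "K \<in> order_ideals M lt"
  shows "(\<Sum>J\<in>{J \<in> ideals. J \<inter> M = K}. f J) = \<beta> K"
proof -
  let ?g = "\<lambda>K. \<Sum>J\<in>{J \<in> ideals. J \<inter> M = K}. f J"
  have chain: "chain_subset {J. f J > 0}" and empty: "f {} = 0"
    and marking: "\<And>p. p \<in> M \<Longrightarrow> mu p = (\<Sum>J\<in>ideals. int (f J) * indicator J p)"
    using f unfolding marked_chains_def by blast+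
  have "chain_expression M lt mu ?g"
    unfolding chain_expression_def
  proof (intro conjI allI impI ballI)
    fix L assume "L \<notin> order_ideals M lt"
    then show "?g L = 0" using restrict_ideal by (intro sum.neutral) blast
  next
    show "?g {} = 0" using ideal_unmarked empty by (intro sum.neutral) auto
  next
    have "\<exists>J. f J > 0 \<and> J \<inter> M = L" if "?g L > 0" for L
    proof (rule ccontr)
      assume "\<not> ?thesis"
      then have "?g L = 0" by (intro sum.neutral) auto
      then show False using that by simp
    qed
    then have "{L. ?g L > 0} \<subseteq> (\<lambda>J. J \<inter> M) ` {J. f J > 0}" by blast
    moreover have "chain_subset ((\<lambda>J. J \<inter> M) ` {J. f J > 0})"
      using chain unfolding chain_subset_def by blast
    ultimately show "chain_subset {L. ?g L > 0}" by (rule chain_subset_mono[rotated])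
  next
    fix p assume "p \<in> M"
    show "mu p = (\<Sum>K\<in>order_ideals M lt. int (?g K) * indicator K p)"
      unfolding marking[OF \<open>p \<in> M\<close>] marked_sum_fibres[OF \<open>p \<in> M\<close>] of_nat_sum ..
  qed
  from chain_expression_unique[OF this \<beta>] show ?thesis by (rule fun_cong)
qed

text \<open>Injectivity is uniqueness of chain combinations, and the fibre sums place the image in
  the dilate. For surjectivity an integer point is straightened to a chain combination, whose
  coefficients are then integers.\<close>

lemma bij_betw_marked_chains_integer_points:
  assumes lam: "dominant M lt lam" "\<forall>p\<in>M. 0 \<le> lam p"
  shows "bij_betw (\<lambda>f. \<Sum>J\<in>ideals. real (f J) *\<^sub>R vertex J)
    (marked_chains P M lt (\<lambda>p. int m * lam p))
    (integer_points ((\<lambda>x. real m *\<^sub>R x) ` nonneg_mrpp P M lt lt' lam))"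
    (is "bij_betw ?\<Phi> ?C ?Z")
proof -
  let ?\<alpha> = "\<lambda>K. m * chain_coeffs M lt lam K"
  have \<alpha>: "chain_expression M lt (\<lambda>p. int m * lam p) ?\<alpha>"
    by (rule chain_expression_scale[OF chain_coeffs[OF lam]])
  have inj: "inj_on ?\<Phi> ?C"
    unfolding marked_chains_def by (intro inj_onI chain_combination_unique) auto
  have into: "?\<Phi> f \<in> ?Z" if f: "f \<in> ?C" for f
  proof -
    have "(\<Sum>J\<in>{J \<in> ideals. J \<inter> M = K}. real (f J)) = real (?\<alpha> K)" if "K \<in> order_ideals M lt" for K
      unfolding marked_chain_fibre_sums[OF f \<alpha> that, symmetric] of_nat_sum ..
    then have "?\<Phi> f \<in> (\<lambda>x. real m *\<^sub>R x) ` nonneg_mrpp P M lt lt' lam"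
      unfolding scaled_nonneg_mrpp by (intro CollectI exI[of _ "\<lambda>J. real (f J)"]) auto
    moreover have "?\<Phi> f $ i \<in> \<int>" for i
      unfolding combination_component by (intro Ints_sum) auto
    ultimately show ?thesis by (simp add: integer_points_def)
  qed
  have onto: "x \<in> ?\<Phi> ` ?C" if x: "x \<in> ?Z" for x
  proof -
    have "x \<in> (\<lambda>x. real m *\<^sub>R x) ` nonneg_mrpp P M lt lt' lam" and int: "\<forall>i. x $ i \<in> \<int>"
      using x unfolding integer_points_def by blast+
    then obtain c0 where c0: "\<forall>J\<in>ideals. 0 \<le> c0 J" "x = (\<Sum>J\<in>ideals. c0 J *\<^sub>R vertex J)"
      and weight: "\<And>K. K \<in> order_ideals M lt \<Longrightarrow>
        (\<Sum>J\<in>{J \<in> ideals. J \<inter> M = K}. c0 J) = real (?\<alpha> K)"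
      unfolding scaled_nonneg_mrpp by blast
    obtain c where c: "\<forall>J. 0 \<le> c J" "\<forall>J. J \<notin> ideals \<longrightarrow> c J = (0::real)" "c {} = 0"
        "chain_subset {J. c J > 0}"
      and xc: "(\<Sum>J\<in>ideals. c J *\<^sub>R vertex J) = x"
      using chain_combination_exists[OF c0(1)] unfolding c0(2) by blast
    have "c J \<in> \<int>" for J
      using chain_combination_integral[OF c] int xc by blast
    then have "\<exists>n. c J = real n" for J
      using c(1) by (metis Ints_cases of_int_0_le_iff of_int_of_nat_eq zero_le_imp_eq_int)
    then obtain f where f: "\<And>J. c J = real (f J)" by metis
    \<comment> \<open>Straightening does not keep track of the fibre totals. The marking equation is
      recovered by evaluating \<open>x\<close> at \<open>p\<close> through both the old weights
      \<open>c0\<close> and the new weights \<open>c\<close>.\<close>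
    have "int m * lam p = (\<Sum>J\<in>ideals. int (f J) * indicator J p)" if p: "p \<in> M" for p
    proof -
      have "real_of_int (\<Sum>J\<in>ideals. int (f J) * indicator J p) = (\<Sum>J\<in>ideals. c J * indicator J p)"
        by (simp add: f indicator_def if_distrib cong: if_cong)
      also have "\<dots> = x $ p" unfolding xc[symmetric] combination_marked[OF p] ..
      also have "\<dots> = (\<Sum>K\<in>order_ideals M lt. real (?\<alpha> K) * indicator K p)"
        unfolding c0(2) combination_marked[OF p] marked_sum_fibres[OF p]
        by (intro sum.cong) (simp_all only: weight)
      also have "\<dots> = real_of_int (\<Sum>K\<in>order_ideals M lt. int (?\<alpha> K) * indicator K p)"
        by (simp add: indicator_def if_distrib cong: if_cong)
      also have "\<dots> = real_of_int (int m * lam p)"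
        using \<alpha> p unfolding chain_expression_def by metis
      finally show ?thesis by (simp only: of_int_eq_iff)
    qed
    then have "f \<in> ?C"
      using c unfolding marked_chains_def f by simp
    moreover have "x = ?\<Phi> f" unfolding xc[symmetric] f ..
    ultimately show ?thesis by blast
  qed
  show ?thesis
    unfolding bij_betw_def using inj into onto by blast
qed

end

section \<open>A common shift and the comparison of two relative orders\<close>

text \<open>The shift chosen in \<open>mrpp\<close> depends on \<open>M\<close> and
  \<open>lam\<close> only, so one \<open>\<beta>\<close> serves all relative orders. A suitable
  shift exists: the sum of all \<open>\<bar>lam q\<bar>\<close>.\<close>

lemma mrpp_shift:
  fixes P M :: "'a::finite set"
  obtains \<beta> where "\<forall>p\<in>M. 0 \<le> lam p + \<beta>"
    and "\<And>lt'. mrpp P M lt lt' lam = shifted_mrpp P M lt lt' lam \<beta>"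
proof -
  have "0 \<le> lam p + (\<Sum>q\<in>M. \<bar>lam q\<bar>)" if "p \<in> M" for p
    using member_le_sum[of p M "\<lambda>q. \<bar>lam q\<bar>"] that by force
  then have "\<exists>\<beta>. \<forall>p\<in>M. 0 \<le> lam p + \<beta>" by blast
  from someI_ex[OF this] that show ?thesis unfolding mrpp_def by blast
qed

lemma lattice_polytope_shifted_mrpp: "lattice_polytope (shifted_mrpp P M lt lt' lam \<beta>)"
  unfolding shifted_mrpp_def
  by (intro lattice_polytope_translate lattice_polytope_nonneg_mrpp) (simp add: indicator_vec_Ints)

text \<open>Dilation turns the shift into a translation by \<open>m * \<beta>\<close> times an
  indicator, which is an integer vector.\<close>

lemma card_integer_points_shifted_mrpp:
  "card (integer_points ((\<lambda>x. real m *\<^sub>R x) ` shifted_mrpp P M lt lt' lam \<beta>)) =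
   card (integer_points ((\<lambda>x. real m *\<^sub>R x) ` nonneg_mrpp P M lt lt' (\<lambda>p. lam p + \<beta>)))"
proof -
  let ?a = "real m *\<^sub>R of_int \<beta> *\<^sub>R indicator_vec (maximals lt' P)"
  have "(\<lambda>x. real m *\<^sub>R x) ` shifted_mrpp P M lt lt' lam \<beta> =
      (\<lambda>x. x - ?a) ` (\<lambda>x. real m *\<^sub>R x) ` nonneg_mrpp P M lt lt' (\<lambda>p. lam p + \<beta>)"
    unfolding shifted_mrpp_def image_image by (simp only: scaleR_diff_right)
  then show ?thesis
    by (simp only:) (rule card_integer_points_translate, simp add: indicator_vec_Ints)
qed

theorem corollary3p1p11:
  fixes P M :: "'a::finite set"
    and lt lt' lt'' :: "'a \<Rightarrow> 'a \<Rightarrow> bool"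
    and lam :: "'a \<Rightarrow> int"
  assumes "strict_order_on P lt"
    and "M \<subseteq> P"
    and "minimals lt P \<subseteq> M"
    and "maximals lt P \<subseteq> M"
    and "dominant M lt lam"
    and "admissible_order P M lt lt'"
    and "admissible_order P M lt lt''"
  shows "ehrhart_equivalent (mrpp P M lt lt' lam) (mrpp P M lt lt'' lam)"
proof -
  obtain \<beta> where \<beta>: "\<forall>p\<in>M. 0 \<le> lam p + \<beta>"
    and shift: "\<And>lt'. mrpp P M lt lt' lam = shifted_mrpp P M lt lt' lam \<beta>"
    using mrpp_shift[of M lam P lt] by blast
  have dom: "dominant M lt (\<lambda>p. lam p + \<beta>)" using assms(5) by (simp add: dominant_def)
  \<comment> \<open>The right-hand side does not involve \<open>l\<close>, so the counts for
    \<open>lt'\<close> and \<open>lt''\<close> agree.\<close>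
  have "card (integer_points ((\<lambda>x. real m *\<^sub>R x) ` mrpp P M lt l lam)) =
      card (marked_chains P M lt (\<lambda>p. int m * (lam p + \<beta>)))"
    if "admissible_order P M lt l" for l m
  proof -
    interpret marked_relative_poset P M lt l
      using assms that by unfold_locales
    show ?thesis
      unfolding shift card_integer_points_shifted_mrpp
      by (rule bij_betw_same_card[OF bij_betw_marked_chains_integer_points[OF dom \<beta>], symmetric])
  qed
  then show ?thesis
    using assms(6,7) unfolding ehrhart_equivalent_def shift
    by (simp add: lattice_polytope_shifted_mrpp)
qed

end
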